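(* Let $0<\epsilon<\frac12$. For real $x\ge 1$ put $N=N(x):=\lfloor x^{\frac12+\epsilon}\rfloor$, let $G(u):=\frac1u\sin\left(\frac1u\right)$ for $u>0$, and define $\mathcal{E}_N(x)$ by the equation $$Q(x)=\sum_{n=1}^{N-1}\frac1n\sin\left(\frac xn\right)+\frac1{2N}\sin\left(\frac xN\right)+\mathrm{Si}\left(\frac xN\right)+\mathcal{E}_N(x).$$ Then for every integer $M\ge 0$, $$\mathcal{E}_N(x)=-\sum_{m=1}^{M}\frac{B_{2m}}{(2m)!}\,\frac{G^{(2m-1)}\left(\frac Nx\right)}{x^{2m}}+O_{M,\epsilon}\left(x^{-\frac12-(4M+3)\epsilon}\right),$$ that is, there is a constant $C>0$ depending only on $M$ and $\epsilon$ such that for all $x\ge 1$ the absolute value of the difference between $\mathcal{E}_N(x)$ and the finite sum $-\sum_{m=1}^{M}\frac{B_{2m}}{(2m)!}\frac{G^{(2m-1)}(N/x)}{x^{2m}}$ is at most $C\,x^{-\frac12-(4M+3)\epsilon}$ (for $M=0$ the sum is empty).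
   Context: The Hardy-Littlewood function is $Q(x):=\sum_{n\ge1}\frac1n\sin\left(\frac xn\right)$. The sine integral is $\mathrm{Si}(x):=\int_0^x\frac{\sin t}{t}\,dt$. $B_n$ denotes the $n$-th Bernoulli number ($B_2=\frac16$, $B_4=-\frac1{30}$, ...). $G^{(k)}$ denotes the $k$-th derivative of $G$, and $\lfloor y\rfloor$ is the integer part of $y$. An empty sum equals $0$. *)

theory Defs
  imports "HOL-Probability.Sinc_Integral"
begin

definition hardy_littlewood_Q :: "real \<Rightarrow> real" where
  "hardy_littlewood_Q x = (\<Sum>n. 1 / real (Suc n) * sin (x / real (Suc n)))"

lemma summable_hardy_littlewood_Q:
  "summable (\<lambda>n. 1 / real (Suc n) * sin (x / real (Suc n)))"
proof (rule summable_comparison_test')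
  have "summable (\<lambda>n. 1 / real n ^ 2)"
    using inverse_power_summable[of 2, where 'a = real] by (simp add: field_simps)
  then have "summable (\<lambda>n. 1 / real (Suc n) ^ 2)"
    by (subst summable_Suc_iff)
  then show "summable (\<lambda>n. \<bar>x\<bar> * (1 / real (Suc n) ^ 2))"
    by (rule summable_mult)
next
  fix n :: nat
  have "\<bar>1 / real (Suc n) * sin (x / real (Suc n))\<bar> \<le> 1 / real (Suc n) * \<bar>x / real (Suc n)\<bar>"
    unfolding abs_mult by (intro mult_mono abs_sin_x_le_abs_x) auto
  also have "\<dots> = \<bar>x\<bar> * (1 / real (Suc n) ^ 2)"
    by (simp add: power2_eq_square)
  finally show "norm (1 / real (Suc n) * sin (x / real (Suc n))) \<le> \<bar>x\<bar> * (1 / real (Suc n) ^ 2)"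
    by simp
qed

text \<open>
  Bernoulli numbers by the standard recurrence, which is
  \<open>(\<Sum>k\<le>n. (n + 1 choose k) * B k) = 0\<close> for \<open>n > 0\<close> solved for \<open>B n\<close>; here \<open>B 1 = -1/2\<close>.
\<close>
fun bernoulli :: "nat \<Rightarrow> real" where
  "bernoulli n =
     (if n = 0 then 1
      else - (\<Sum>k<n. real (Suc n choose k) * bernoulli k) / real (Suc n))"

declare bernoulli.simps [simp del]

lemma bernoulli_2_4: "bernoulli 2 = 1 / 6" "bernoulli 4 = - 1 / 30"
proof -
  have b0: "bernoulli 0 = 1" by (simp add: bernoulli.simps)
  have b1: "bernoulli (Suc 0) = - 1 / 2" by (subst bernoulli.simps) (simp add: b0)
  have b2: "bernoulli (Suc (Suc 0)) = 1 / 6"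
    by (subst bernoulli.simps) (simp add: b0 b1)
  have b3: "bernoulli (Suc (Suc (Suc 0))) = 0"
    by (subst bernoulli.simps) (simp add: b0 b1 b2)
  have b4: "bernoulli (Suc (Suc (Suc (Suc 0)))) = - 1 / 30"
    by (subst bernoulli.simps) (simp add: b0 b1 b2 b3)
  from b2 b4 show "bernoulli 2 = 1 / 6" "bernoulli 4 = - 1 / 30"
    by (simp_all add: eval_nat_numeral)
qed

definition cutoff :: "real \<Rightarrow> real \<Rightarrow> nat" where
  "cutoff \<epsilon> x = nat \<lfloor>x powr (1 / 2 + \<epsilon>)\<rfloor>"

text \<open>Only the values of \<open>G\<close> at \<open>u > 0\<close> are meaningful.\<close>
definition G :: "real \<Rightarrow> real" where
  "G u = 1 / u * sin (1 / u)"

definition Q_error :: "nat \<Rightarrow> real \<Rightarrow> real" where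
  "Q_error N x = hardy_littlewood_Q x -
     ((\<Sum>n = 1..N - 1. 1 / real n * sin (x / real n))
      + 1 / (2 * real N) * sin (x / real N)
      + Si (x / real N))"

end

theory Submission
  imports Defs "HOL-Computational_Algebra.Formal_Power_Series" "HOL-Library.Landau_Symbols"
begin

text \<open>
  The tail \<open>\<Sum>n\<ge>N. f n\<close> of \<open>Q\<close>, with \<open>f t = sin (x / t) / t\<close>, is evaluated by Euler--Maclaurin
  summation. Write \<open>D 1 = f\<close>, let \<open>D 0 t = - Si (x / t)\<close> be the antiderivative of \<open>f\<close> vanishing at
  infinity and \<open>D (k + 1)\<close> the \<open>k\<close>-th derivative of \<open>f\<close>. Expanding each \<open>D k (n + 1)\<close> in a Taylor
  polynomial at \<open>n\<close>, the recurrence of the Bernoulli numbers shows that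
  \<open>T = (\<Sum>k\<le>K. B k / k! * D k)\<close> satisfies \<open>T (n + 1) - T n = f n\<close> up to \<open>O (sup \<bar>D (K + 1)\<bar>)\<close>, without
  any use of Bernoulli polynomials; summing over \<open>n\<close> gives \<open>- T N\<close> for the tail.

  Since \<open>f t = G (t / x) / x\<close> and \<open>G^(k) u = Im (P\<^sub>k (1 / u) * exp (\<i> / u))\<close> with \<open>P\<^sub>k\<close> of degree at
  most \<open>2 k + 1\<close>, for \<open>N \<le> x\<close> the \<open>m\<close>-th correction is \<open>O ((x / N\<^sup>2)^(2 m) * (N / x))\<close> and the
  remainder after \<open>L\<close> corrections is \<open>O ((x / N\<^sup>2)^(2 L))\<close>. For \<open>N\<close> of order \<open>x powr (1 / 2 + \<epsilon>)\<close> one has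
  \<open>x / N\<^sup>2 = O (x powr (- 2 \<epsilon>))\<close>, so it suffices to expand far beyond \<open>M\<close> and to discard the
  corrections with \<open>m > M\<close>.
\<close>

subsection \<open>The Bernoulli numbers\<close>

lemma bernoulli_0 [simp]: "bernoulli 0 = 1"
  by (simp add: bernoulli.simps)

lemma sum_bernoulli_binomial:
  "(\<Sum>k<n. real (n choose k) * bernoulli k) = (if n = 1 then 1 else 0)"
proof (cases n)
  case (Suc m)
  show ?thesis
  proof (cases "m = 0")
    case False
    then have "real (Suc m) * bernoulli m = - (\<Sum>k<m. real (Suc m choose k) * bernoulli k)"
      by (subst bernoulli.simps) simp
    with Suc False show ?thesis
      by (simp del: of_nat_Suc binomial_Suc_Suc)
  qed (simp add: Suc)
qed simp

lemma bernoulli_convolution: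
  "(\<Sum>k\<le>n. bernoulli k / (fact k * fact (n - k))) = bernoulli n / fact n + (if n = 1 then 1 else 0)"
proof -
  have "(\<Sum>k<n. bernoulli k / (fact k * fact (n - k)))
      = (\<Sum>k<n. real (n choose k) * bernoulli k) / fact n"
    unfolding sum_divide_distrib by (intro sum.cong refl) (simp add: binomial_fact)
  then show ?thesis
    unfolding sum_bernoulli_binomial lessThan_Suc_atMost [symmetric] by simp
qed

definition bernoulli_fps :: "real fps" where
  "bernoulli_fps = Abs_fps (\<lambda>n. bernoulli n / fact n)"

lemma bernoulli_fps_times_exp: "bernoulli_fps * fps_exp 1 = bernoulli_fps + fps_X"
  by (rule fps_ext)
    (simp add: bernoulli_fps_def fps_mult_nth atLeast0AtMost bernoulli_convolution)

lemma bernoulli_fps_compose_uminus: "bernoulli_fps oo (- fps_X) = bernoulli_fps + fps_X"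
proof -
  define b where "b = bernoulli_fps oo (- fps_X)"
  have exp_uminus: "fps_exp 1 oo (- fps_X) = fps_exp (- 1 :: real)"
    by (rule fps_ext) (simp add: fps_compose_uminus' fps_exp_def)
  have "b * fps_exp (- 1) = (bernoulli_fps * fps_exp 1) oo (- fps_X)"
    by (simp add: b_def fps_compose_mult_distrib exp_uminus)
  also have "\<dots> = b - fps_X"
    by (simp add: b_def bernoulli_fps_times_exp fps_compose_add_distrib)
  finally have "b = (b - fps_X) * fps_exp 1"
    by (metis fps_exp_add_mult fps_exp_0 add.left_inverse mult.assoc mult.right_neutral)
  then have "(b - (bernoulli_fps + fps_X)) * (fps_exp 1 - 1) = 0"
    using bernoulli_fps_times_exp by (simp add: algebra_simps)
  moreover have "fps_exp 1 - 1 \<noteq> (0 :: real fps)"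
    using fps_nonzeroI [of "fps_exp 1 - 1" 1] by simp
  ultimately show ?thesis
    unfolding b_def using mult_eq_0_iff by fastforce
qed

lemma bernoulli_odd_eq_0:
  assumes "odd n" "n \<noteq> 1"
  shows "bernoulli n = 0"
proof -
  have "fps_nth (bernoulli_fps oo (- fps_X)) n = fps_nth (bernoulli_fps + fps_X) n"
    by (simp only: bernoulli_fps_compose_uminus)
  with assms show ?thesis
    by (simp add: fps_compose_uminus' bernoulli_fps_def)
qed

lemma sum_bernoulli_even:
  assumes "L > 0"
  shows "(\<Sum>k\<le>2 * L. bernoulli k * c k) = c 0 - c 1 / 2 + (\<Sum>m=1..L. bernoulli (2 * m) * c (2 * m))"
  using assms
proof (induction L rule: nat_induct_non_zero)
  case 1
  have "bernoulli (Suc 0) = - 1 / 2"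
    by (subst bernoulli.simps) simp
  then show ?case
    by (simp add: numeral_2_eq_2)
next
  case (Suc L)
  then show ?case
    using bernoulli_odd_eq_0 [of "Suc (2 * L)"] by simp
qed

subsection \<open>Euler--Maclaurin summation\<close>

definition bernoulli_operator :: "nat \<Rightarrow> (nat \<Rightarrow> real \<Rightarrow> real) \<Rightarrow> real \<Rightarrow> real" where
  "bernoulli_operator K D t = (\<Sum>k\<le>K. bernoulli k / fact k * D k t)"

lemma sum_bernoulli_taylor:
  fixes d :: "nat \<Rightarrow> real"
  assumes "K \<ge> 1"
  shows "(\<Sum>k\<le>K. bernoulli k / fact k * (\<Sum>j\<le>K - k. d (k + j) / fact j))
    = (\<Sum>k\<le>K. bernoulli k / fact k * d k) + d 1"
proof -
  have triangle: "{(k, j). k + j \<le> K} = Sigma {..K} (\<lambda>k. {..K - k})"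
    by auto
  have "(\<Sum>k\<le>K. bernoulli k / fact k * (\<Sum>j\<le>K - k. d (k + j) / fact j))
      = (\<Sum>(k, j)\<in>{(k, j). k + j \<le> K}. bernoulli k / (fact k * fact j) * d (k + j))"
    unfolding triangle by (subst sum.Sigma [symmetric]) (auto simp: sum_distrib_left)
  also have "\<dots> = (\<Sum>r\<le>K. (\<Sum>k\<le>r. bernoulli k / (fact k * fact (r - k))) * d r)"
    unfolding sum.triangle_reindex_eq sum_distrib_right by (intro sum.cong refl) simp
  also have "\<dots> = (\<Sum>r\<le>K. bernoulli r / fact r * d r) + (\<Sum>r\<le>K. if r = 1 then d r else 0)"
    unfolding bernoulli_convolution sum.distrib [symmetric]
    by (intro sum.cong refl) (simp add: distrib_right)
  finally show ?thesis
    using assms by simp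
qed

lemma taylor_remainder_le:
  fixes D :: "nat \<Rightarrow> real \<Rightarrow> real"
  assumes "a < b"
    and deriv: "\<And>k t. k \<le> n \<Longrightarrow> t \<in> {a..b} \<Longrightarrow> (D k has_real_derivative D (Suc k) t) (at t)"
    and bound: "\<And>t. t \<in> {a..b} \<Longrightarrow> \<bar>D (Suc n) t\<bar> \<le> B"
  shows "\<bar>D 0 b - (\<Sum>j\<le>n. D j a / fact j * (b - a) ^ j)\<bar> \<le> B * (b - a) ^ Suc n / fact (Suc n)"
proof -
  have "\<exists>t. a < t \<and> t < b \<and> D 0 b =
      (\<Sum>j<Suc n. D j a / fact j * (b - a) ^ j) + D (Suc n) t / fact (Suc n) * (b - a) ^ Suc n"
    by (rule Taylor_up [where a = a]) (use \<open>a < b\<close> deriv in auto)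
  then obtain t where t: "a < t" "t < b" and taylor: "D 0 b =
      (\<Sum>j\<le>n. D j a / fact j * (b - a) ^ j) + D (Suc n) t / fact (Suc n) * (b - a) ^ Suc n"
    unfolding lessThan_Suc_atMost by blast
  have "\<bar>D 0 b - (\<Sum>j\<le>n. D j a / fact j * (b - a) ^ j)\<bar>
      = \<bar>D (Suc n) t\<bar> * (b - a) ^ Suc n / fact (Suc n)"
    using \<open>a < b\<close> unfolding taylor by (simp add: abs_mult del: fact_Suc power_Suc)
  also have "\<dots> \<le> B * (b - a) ^ Suc n / fact (Suc n)"
    using t bound [of t] \<open>a < b\<close> by (intro divide_right_mono mult_right_mono) auto
  finally show ?thesis .
qed

lemma euler_maclaurin_step:
  fixes D :: "nat \<Rightarrow> real \<Rightarrow> real"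
  assumes "K \<ge> 1"
    and deriv: "\<And>k t. k \<le> K \<Longrightarrow> t \<in> {a..a + 1} \<Longrightarrow> (D k has_real_derivative D (Suc k) t) (at t)"
    and bound: "\<And>t. t \<in> {a..a + 1} \<Longrightarrow> \<bar>D (Suc K) t\<bar> \<le> B"
  shows "\<bar>bernoulli_operator K D (a + 1) - bernoulli_operator K D a - D 1 a\<bar>
    \<le> (\<Sum>k\<le>K. \<bar>bernoulli k\<bar> / fact k) * B"
proof -
  define R where "R k = D k (a + 1) - (\<Sum>j\<le>K - k. D (k + j) a / fact j)" for k
  have "B \<ge> 0"
    using bound [of a] by fastforce
  have R_le: "\<bar>R k\<bar> \<le> B" if "k \<le> K" for k
  proof -
    have "\<bar>R k\<bar> \<le> B / fact (Suc (K - k))"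
      using taylor_remainder_le [of a "a + 1" "K - k" "\<lambda>j. D (k + j)" B] that deriv bound
      by (simp add: R_def del: fact_Suc)
    also have "\<dots> \<le> B / 1"
      using \<open>B \<ge> 0\<close> by (intro divide_left_mono fact_ge_1) auto
    finally show ?thesis by simp
  qed
  have "bernoulli_operator K D (a + 1) - bernoulli_operator K D a - D 1 a
      = (\<Sum>k\<le>K. bernoulli k / fact k * R k)"
    using sum_bernoulli_taylor [OF \<open>K \<ge> 1\<close>, of "\<lambda>k. D k a"]
    by (simp add: bernoulli_operator_def R_def right_diff_distrib sum_subtractf)
  also have "\<bar>\<dots>\<bar> \<le> (\<Sum>k\<le>K. \<bar>bernoulli k / fact k * R k\<bar>)"
    by (rule sum_abs)
  also have "\<dots> \<le> (\<Sum>k\<le>K. \<bar>bernoulli k\<bar> / fact k * B)"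
    unfolding abs_mult abs_divide abs_of_nonneg [OF fact_ge_zero]
    by (intro sum_mono mult_left_mono R_le) auto
  finally show ?thesis
    by (simp add: sum_distrib_right)
qed

lemma euler_maclaurin_tail:
  fixes D :: "nat \<Rightarrow> real \<Rightarrow> real" and B :: "nat \<Rightarrow> real"
  assumes "K \<ge> 1"
    and deriv: "\<And>k t. k \<le> K \<Longrightarrow> real N \<le> t \<Longrightarrow> (D k has_real_derivative D (Suc k) t) (at t)"
    and lim: "\<And>k. k \<le> K \<Longrightarrow> (D k \<longlongrightarrow> 0) at_top"
    and bound: "\<And>n t. real (n + N) \<le> t \<Longrightarrow> \<bar>D (Suc K) t\<bar> \<le> B n"
    and "B sums S" and summable: "summable (\<lambda>n. D 1 (real (n + N)))"
  shows "\<bar>(\<Sum>n. D 1 (real (n + N))) + bernoulli_operator K D (real N)\<bar>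
    \<le> (\<Sum>k\<le>K. \<bar>bernoulli k\<bar> / fact k) * S"
proof -
  define T where "T = bernoulli_operator K D"
  define c where "c = (\<Sum>k\<le>K. \<bar>bernoulli k\<bar> / fact k)"
  define \<rho> where "\<rho> n = T (real (Suc n + N)) - T (real (n + N)) - D 1 (real (n + N))" for n
  have \<rho>_le: "norm (\<rho> n) \<le> c * B n" for n
    using euler_maclaurin_step [OF \<open>K \<ge> 1\<close>, of "real (n + N)" D "B n"] deriv bound [of n]
    unfolding \<rho>_def T_def c_def by (simp add: add_ac)
  have "(T \<longlongrightarrow> (\<Sum>k\<le>K. bernoulli k / fact k * 0)) at_top"
    unfolding T_def bernoulli_operator_def
    by (intro tendsto_sum tendsto_mult tendsto_const lim) simp
  then have "(T \<longlongrightarrow> 0) at_top"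
    by simp
  moreover have "filterlim (\<lambda>n. real (n + N)) at_top sequentially"
    by real_asymp
  ultimately have "(\<lambda>n. T (real (n + N))) \<longlonglongrightarrow> 0"
    by (rule filterlim_compose)
  from telescope_sums [OF this]
  have "(\<lambda>n. T (real (Suc n + N)) - T (real (n + N))) sums (- T (real N))"
    by simp
  from sums_diff [OF this summable_sums [OF summable]]
  have "\<rho> sums (- T (real N) - (\<Sum>n. D 1 (real (n + N))))"
    unfolding \<rho>_def .
  moreover have cB: "(\<lambda>n. c * B n) sums (c * S)"
    using \<open>B sums S\<close> by (rule sums_mult)
  ultimately have "norm (- T (real N) - (\<Sum>n. D 1 (real (n + N)))) \<le> c * S"
    using norm_suminf_le [OF \<rho>_le sums_summable [OF cB]] by (simp add: sums_iff)
  then show ?thesis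
    by (simp add: T_def c_def abs_minus_commute add.commute)
qed

lemma inverse_square_le_telescoping:
  fixes a :: real
  assumes "a \<ge> 1"
  shows "1 / a\<^sup>2 \<le> 2 * (1 / a - 1 / (a + 1))"
proof -
  have "1 / a\<^sup>2 \<le> 1 / (a * (a + 1) / 2)"
    using assms by (intro divide_left_mono) (auto simp: power2_eq_square)
  also have "\<dots> = 2 * (1 / a - 1 / (a + 1))"
    using assms by (simp add: field_simps)
  finally show ?thesis .
qed

corollary euler_maclaurin_tail_quadratic_decay:
  fixes D :: "nat \<Rightarrow> real \<Rightarrow> real"
  assumes "K \<ge> 1" "N > 0"
    and deriv: "\<And>k t. k \<le> K \<Longrightarrow> real N \<le> t \<Longrightarrow> (D k has_real_derivative D (Suc k) t) (at t)"
    and lim: "\<And>k. k \<le> K \<Longrightarrow> (D k \<longlongrightarrow> 0) at_top"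
    and decay: "\<And>t. real N \<le> t \<Longrightarrow> \<bar>D (Suc K) t\<bar> \<le> A / t\<^sup>2"
    and summable: "summable (\<lambda>n. D 1 (real (n + N)))"
  shows "\<bar>(\<Sum>n. D 1 (real (n + N))) + bernoulli_operator K D (real N)\<bar>
    \<le> (\<Sum>k\<le>K. \<bar>bernoulli k\<bar> / fact k) * (2 * A / real N)"
proof -
  define B where "B n = 2 * A * (1 / real (n + N) - 1 / real (Suc n + N))" for n
  have "0 \<le> A / (real N)\<^sup>2"
    using decay [of "real N"] by linarith
  then have "A \<ge> 0"
    using \<open>N > 0\<close> by (simp add: zero_le_divide_iff)
  have B_bound: "\<bar>D (Suc K) t\<bar> \<le> B n" if "real (n + N) \<le> t" for n t
  proof -
    define a where "a = real (n + N)"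
    have "a \<ge> 1" "a \<le> t" "real N \<le> t"
      using \<open>N > 0\<close> that by (auto simp: a_def)
    have "\<bar>D (Suc K) t\<bar> \<le> A / t\<^sup>2"
      using \<open>real N \<le> t\<close> by (rule decay)
    also have "\<dots> \<le> A / a\<^sup>2"
      using \<open>A \<ge> 0\<close> \<open>a \<ge> 1\<close> \<open>a \<le> t\<close> by (intro divide_left_mono power_mono) auto
    also have "\<dots> \<le> A * (2 * (1 / a - 1 / (a + 1)))"
      using mult_left_mono [OF inverse_square_le_telescoping [OF \<open>a \<ge> 1\<close>] \<open>A \<ge> 0\<close>] by simp
    finally show ?thesis
      by (simp add: B_def a_def add_ac mult_ac)
  qed
  have B_sums: "B sums (2 * A * (1 / real N))"
  proof -
    have "(\<lambda>n. 1 / real (n + N)) \<longlonglongrightarrow> 0"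
      by real_asymp
    from telescope_sums' [OF this] show ?thesis
      unfolding B_def by (intro sums_mult) simp
  qed
  show ?thesis
    using euler_maclaurin_tail [OF \<open>K \<ge> 1\<close> deriv lim B_bound B_sums summable] by simp
qed

subsection \<open>The derivatives of \<open>G\<close>\<close>

definition poly_exp_inverse :: "complex poly \<Rightarrow> complex \<Rightarrow> complex" where
  "poly_exp_inverse p z = poly p (1 / z) * exp (\<i> / z)"

lemma has_field_derivative_poly_exp_inverse:
  assumes "z \<noteq> 0"
  shows "(poly_exp_inverse p has_field_derivative
    - (1 / z)\<^sup>2 * poly_exp_inverse (pderiv p + smult \<i> p) z) (at z)"
  unfolding poly_exp_inverse_def [abs_def]
  by (rule derivative_eq_intros DERIV_chain2 [OF poly_DERIV] refl | use assms in \<open>simp; fail\<close>)+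
    (use assms in \<open>simp add: field_simps power2_eq_square\<close>)

lemma has_real_derivative_Im_poly_exp_inverse:
  assumes "u \<noteq> 0"
  shows "((\<lambda>u. Im (poly_exp_inverse p (of_real u))) has_real_derivative
    - (1 / u)\<^sup>2 * Im (poly_exp_inverse (pderiv p + smult \<i> p) (of_real u))) (at u)"
proof -
  have "((\<lambda>u. Im (poly_exp_inverse p (of_real u))) has_real_derivative
      Im (- (1 / of_real u)\<^sup>2 * poly_exp_inverse (pderiv p + smult \<i> p) (of_real u))) (at u)"
    by (intro has_field_derivative_Im has_vector_derivative_real_field
      has_field_derivative_poly_exp_inverse) (use assms in simp)
  also have "- (1 / complex_of_real u)\<^sup>2 = of_real (- (1 / u)\<^sup>2)"
    by simp
  finally show ?thesis
    by (simp only: scaleR_conv_of_real [symmetric] scaleR_complex.sel)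
qed

lemma norm_poly_le_max_power:
  fixes p :: "'a :: real_normed_field poly"
  assumes "degree p \<le> d"
  shows "norm (poly p z) \<le> (\<Sum>i\<le>degree p. norm (coeff p i)) * max 1 (norm z) ^ d"
proof -
  have "norm (poly p z) \<le> (\<Sum>i\<le>degree p. norm (coeff p i) * norm z ^ i)"
    unfolding poly_altdef by (rule norm_sum [THEN order_trans]) (simp add: norm_mult norm_power)
  also have "\<dots> \<le> (\<Sum>i\<le>degree p. norm (coeff p i) * max 1 (norm z) ^ d)"
  proof (intro sum_mono mult_left_mono)
    fix i assume "i \<in> {..degree p}"
    have "norm z ^ i \<le> max 1 (norm z) ^ i"
      by (intro power_mono) auto
    also have "\<dots> \<le> max 1 (norm z) ^ d"
      using \<open>i \<in> {..degree p}\<close> assms by (intro power_increasing) auto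
    finally show "norm z ^ i \<le> max 1 (norm z) ^ d" .
  qed simp
  finally show ?thesis
    by (simp add: sum_distrib_right)
qed

lemma abs_Im_poly_exp_inverse_le:
  assumes "degree p \<le> d" "u > 0"
  shows "\<bar>Im (poly_exp_inverse p (of_real u))\<bar>
    \<le> (\<Sum>i\<le>degree p. norm (coeff p i)) * max 1 (1 / u) ^ d"
proof -
  have "\<bar>Im (poly_exp_inverse p (of_real u))\<bar> \<le> norm (poly p (1 / of_real u) * exp (\<i> / of_real u))"
    unfolding poly_exp_inverse_def by (rule abs_Im_le_cmod)
  also have "\<dots> = norm (poly p (1 / of_real u))"
    by (simp add: norm_mult)
  also have "\<dots> \<le> (\<Sum>i\<le>degree p. norm (coeff p i)) * max 1 (1 / u) ^ d"
    using norm_poly_le_max_power [OF \<open>degree p \<le> d\<close>, of "1 / of_real u"] \<open>u > 0\<close>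
    by (simp add: norm_divide)
  finally show ?thesis .
qed

lemma has_real_derivative_eq_Im_poly_exp_inverse:
  assumes "\<And>u. u > 0 \<Longrightarrow> g u = Im (poly_exp_inverse p (of_real u))" "u > 0"
  shows "(g has_real_derivative
    - (1 / u)\<^sup>2 * Im (poly_exp_inverse (pderiv p + smult \<i> p) (of_real u))) (at u)"
  by (rule has_field_derivative_transform_within_open
      [OF has_real_derivative_Im_poly_exp_inverse, where S = "{0<..}"]) (use assms in auto)

lemma degree_pderiv_add_smult_le:
  fixes p :: "'a :: {comm_semiring_1, semiring_no_zero_divisors, semiring_char_0} poly"
  shows "degree (pderiv p + smult c p) \<le> degree p"
  using degree_pderiv [of p] by (intro degree_add_le) auto

lemma higher_deriv_G_eq_Im:
  obtains p where "degree p \<le> 2 * k + 1"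
    "\<And>u. u > 0 \<Longrightarrow> (deriv ^^ k) G u = Im (poly_exp_inverse p (of_real u))"
proof (induction k arbitrary: thesis)
  case 0
  have "G u = Im (poly_exp_inverse [:0, 1:] (of_real u))" for u
  proof -
    have "exp (\<i> / of_real u) = cis (1 / u)"
      by (simp add: cis_conv_exp)
    then show ?thesis
      by (simp add: G_def poly_exp_inverse_def Im_divide_of_real)
  qed
  then show ?case
    by (intro 0 [of "[:0, 1:]"]) auto
next
  case (Suc k)
  obtain p where degree: "degree p \<le> 2 * k + 1"
    and eq: "\<And>u. u > 0 \<Longrightarrow> (deriv ^^ k) G u = Im (poly_exp_inverse p (of_real u))"
    using Suc.IH by blast
  define q where "q = pderiv p + smult \<i> p"
  have "degree q \<le> 2 * k + 1"
    unfolding q_def using degree_pderiv_add_smult_le degree by (rule order_trans)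
  then have "degree (monom (- 1) 2 * q) \<le> 2 * Suc k + 1"
    using degree_mult_le [of "monom (- 1) 2" q] degree_monom_le [of "- 1 :: complex" 2] by simp
  moreover have "(deriv ^^ Suc k) G u = Im (poly_exp_inverse (monom (- 1) 2 * q) (of_real u))"
    if "u > 0" for u
  proof -
    have "(deriv ^^ Suc k) G u = - (1 / u)\<^sup>2 * Im (poly_exp_inverse q (of_real u))"
      using DERIV_imp_deriv [OF has_real_derivative_eq_Im_poly_exp_inverse [OF eq that]]
      by (simp add: q_def)
    also have "\<dots> = Im (of_real (- (1 / u)\<^sup>2) * poly_exp_inverse q (of_real u))"
      by (simp only: scaleR_conv_of_real [symmetric] scaleR_complex.sel)
    finally show ?thesis
      by (simp add: poly_exp_inverse_def poly_monom mult.assoc)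
  qed
  ultimately show ?case
    by (rule Suc.prems)
qed

lemma has_real_derivative_higher_deriv_G:
  assumes "u > 0"
  shows "((deriv ^^ k) G has_real_derivative (deriv ^^ Suc k) G u) (at u)"
proof -
  obtain p where "\<And>u. u > 0 \<Longrightarrow> (deriv ^^ k) G u = Im (poly_exp_inverse p (of_real u))"
    using higher_deriv_G_eq_Im [of k] by blast
  note has_deriv = has_real_derivative_eq_Im_poly_exp_inverse [OF this assms]
  then show ?thesis
    using DERIV_imp_deriv [OF has_deriv] by simp
qed

lemma abs_higher_deriv_G_le:
  obtains C where "C \<ge> 0"
    "\<And>u. u > 0 \<Longrightarrow> \<bar>(deriv ^^ Suc k) G u\<bar> \<le> C * (1 / u)\<^sup>2 * max 1 (1 / u) ^ (2 * k + 1)"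
proof -
  obtain p where degree: "degree p \<le> 2 * k + 1"
    and eq: "\<And>u. u > 0 \<Longrightarrow> (deriv ^^ k) G u = Im (poly_exp_inverse p (of_real u))"
    using higher_deriv_G_eq_Im [of k] by blast
  define q where "q = pderiv p + smult \<i> p"
  have "degree q \<le> 2 * k + 1"
    unfolding q_def using degree_pderiv_add_smult_le degree by (rule order_trans)
  define C where "C = (\<Sum>i\<le>degree q. norm (coeff q i))"
  show thesis
  proof (rule that)
    show "C \<ge> 0"
      unfolding C_def by (intro sum_nonneg) simp
    fix u :: real
    assume "u > 0"
    have "\<bar>(deriv ^^ Suc k) G u\<bar> = (1 / u)\<^sup>2 * \<bar>Im (poly_exp_inverse q (of_real u))\<bar>"
      using DERIV_imp_deriv [OF has_real_derivative_eq_Im_poly_exp_inverse [OF eq \<open>u > 0\<close>]]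
      by (simp add: q_def abs_mult)
    also have "\<dots> \<le> (1 / u)\<^sup>2 * (C * max 1 (1 / u) ^ (2 * k + 1))"
      unfolding C_def using \<open>degree q \<le> 2 * k + 1\<close> \<open>u > 0\<close>
      by (intro mult_left_mono abs_Im_poly_exp_inverse_le) auto
    finally show "\<bar>(deriv ^^ Suc k) G u\<bar> \<le> C * (1 / u)\<^sup>2 * max 1 (1 / u) ^ (2 * k + 1)"
      by (simp only: mult_ac)
  qed
qed

lemma tendsto_higher_deriv_G_at_top: "((deriv ^^ k) G \<longlongrightarrow> 0) at_top"
proof (cases k)
  case 0
  have "(G \<longlongrightarrow> 0) at_top"
    unfolding G_def [abs_def] by real_asymp
  with 0 show ?thesis by simp
next
  case (Suc j)
  obtain C where bound: "\<And>u. u > 0 \<Longrightarrow>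
      \<bar>(deriv ^^ Suc j) G u\<bar> \<le> C * (1 / u)\<^sup>2 * max 1 (1 / u) ^ (2 * j + 1)"
    using abs_higher_deriv_G_le [of j] by blast
  show ?thesis
    unfolding Suc
  proof (rule Lim_null_comparison)
    show "\<forall>\<^sub>F u in at_top. norm ((deriv ^^ Suc j) G u) \<le> C * (1 / u)\<^sup>2"
      using eventually_ge_at_top [of 1]
    proof eventually_elim
      case (elim u)
      then show ?case
        using bound [of u] by (simp add: max_absorb1)
    qed
    show "((\<lambda>u::real. C * (1 / u)\<^sup>2) \<longlongrightarrow> 0) at_top"
      by real_asymp
  qed
qed

subsection \<open>The tail of \<open>Q\<close>\<close>

primrec summand_tower :: "real \<Rightarrow> nat \<Rightarrow> real \<Rightarrow> real" where
  "summand_tower x 0 = (\<lambda>t. - Si (x / t))"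
| "summand_tower x (Suc k) = (\<lambda>t. (deriv ^^ k) G (t / x) / x ^ Suc k)"

lemma summand_tower_1: "x \<noteq> 0 \<Longrightarrow> summand_tower x 1 t = 1 / t * sin (x / t)"
  by (simp add: G_def)

lemma has_real_derivative_summand_tower:
  assumes "x > 0" "t > 0"
  shows "(summand_tower x k has_real_derivative summand_tower x (Suc k) t) (at t)"
proof (cases k)
  case 0
  have "((\<lambda>t. - Si (x / t)) has_real_derivative - (sinc (x / t) * (- x / t\<^sup>2))) (at t)"
    by (rule derivative_eq_intros DERIV_chain2 [OF DERIV_Si] refl | use assms in \<open>simp; fail\<close>)+
      (use assms in \<open>simp add: power2_eq_square\<close>)
  moreover have "- (sinc (x / t) * (- x / t\<^sup>2)) = summand_tower x 1 t"
    using assms by (simp add: summand_tower_1 power2_eq_square del: summand_tower.simps One_nat_def)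
  ultimately show ?thesis
    by (simp add: 0)
next
  case (Suc j)
  have "((\<lambda>t. (deriv ^^ j) G (t / x) / x ^ Suc j) has_real_derivative
      (deriv ^^ Suc j) G (t / x) * (1 / x) / x ^ Suc j) (at t)"
    by (intro DERIV_cdivide DERIV_chain2 [OF has_real_derivative_higher_deriv_G] DERIV_ident)
      (use assms in auto)
  then show ?thesis
    by (simp add: Suc)
qed

lemma tendsto_summand_tower_at_top:
  assumes "x > 0"
  shows "(summand_tower x k \<longlongrightarrow> 0) at_top"
proof (cases k)
  case 0
  have "Si 0 = 0"
    by (simp add: Si_def zero_ereal_def [symmetric])
  moreover have "((\<lambda>t. x / t) \<longlongrightarrow> 0) at_top"
    by real_asymp
  then have "((\<lambda>t. - Si (x / t)) \<longlongrightarrow> - Si 0) at_top"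
    by (intro tendsto_minus isCont_tendsto_compose [OF isCont_Si])
  ultimately show ?thesis
    by (simp add: 0)
next
  case (Suc j)
  have "filterlim (\<lambda>t. t / x) at_top at_top"
    using \<open>x > 0\<close> by real_asymp
  then have "((\<lambda>t. (deriv ^^ j) G (t / x) / x ^ Suc j) \<longlongrightarrow> 0 / x ^ Suc j) at_top"
    by (intro tendsto_divide tendsto_const filterlim_compose [OF tendsto_higher_deriv_G_at_top])
      (use \<open>x > 0\<close> in auto)
  then show ?thesis
    by (simp add: Suc)
qed

lemma abs_summand_tower_le:
  assumes "k > 0"
  obtains C where
    "\<And>a x t. 0 < a \<Longrightarrow> a \<le> x \<Longrightarrow> a \<le> t \<Longrightarrow>
      \<bar>summand_tower x (Suc k) t\<bar> \<le> C * (x / a\<^sup>2) ^ k * a / t\<^sup>2"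
proof -
  obtain j where k: "k = Suc j"
    using assms gr0_conv_Suc by blast
  obtain C where "C \<ge> 0" and bound: "\<And>u. u > 0 \<Longrightarrow>
      \<bar>(deriv ^^ k) G u\<bar> \<le> C * (1 / u)\<^sup>2 * max 1 (1 / u) ^ (2 * j + 1)"
    using abs_higher_deriv_G_le [of j] unfolding k by blast
  show thesis
  proof (rule that)
    fix a x t :: real
    assume "0 < a" "a \<le> x" "a \<le> t"
    then have "x / t \<le> x / a"
      by (intro divide_left_mono) auto
    have "\<bar>(deriv ^^ k) G (t / x)\<bar> \<le> C * (x / t)\<^sup>2 * max 1 (x / t) ^ (2 * j + 1)"
      using bound [of "t / x"] \<open>0 < a\<close> \<open>a \<le> x\<close> \<open>a \<le> t\<close> by simp
    also have "\<dots> \<le> C * (x / t)\<^sup>2 * (x / a) ^ (2 * j + 1)"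
      using \<open>x / t \<le> x / a\<close> \<open>C \<ge> 0\<close> \<open>0 < a\<close> \<open>a \<le> x\<close> by (intro mult_left_mono power_mono) auto
    finally have "\<bar>summand_tower x (Suc k) t\<bar> \<le> C * (x / t)\<^sup>2 * (x / a) ^ (2 * j + 1) / x ^ Suc k"
      using \<open>0 < a\<close> \<open>a \<le> x\<close> by (simp add: divide_right_mono del: power_Suc)
    also have "\<dots> = C * (x / a\<^sup>2) ^ k * a / t\<^sup>2"
      using \<open>0 < a\<close> \<open>a \<le> x\<close>
      by (simp add: k power_divide power2_eq_square power_mult_distrib mult_2 power_add)
    finally show "\<bar>summand_tower x (Suc k) t\<bar> \<le> C * (x / a\<^sup>2) ^ k * a / t\<^sup>2" .
  qed
qed

lemma summable_summand_tower_1: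
  assumes "x \<noteq> 0"
  shows "summable (\<lambda>n. summand_tower x 1 (real (n + N)))"
  using summable_hardy_littlewood_Q [of x]
  unfolding summand_tower_1 [OF assms, symmetric]
    summable_Suc_iff [of "\<lambda>n. summand_tower x 1 (real n)"]
    summable_iff_shift [of "\<lambda>n. summand_tower x 1 (real n)" N] .

lemma hardy_littlewood_Q_split:
  assumes "x \<noteq> 0" "N > 0"
  shows "hardy_littlewood_Q x
    = (\<Sum>n=1..N - 1. 1 / real n * sin (x / real n)) + (\<Sum>n. summand_tower x 1 (real (n + N)))"
proof -
  have "hardy_littlewood_Q x
      = (\<Sum>n. 1 / real (Suc (n + (N - 1))) * sin (x / real (Suc (n + (N - 1)))))
      + (\<Sum>n<N - 1. 1 / real (Suc n) * sin (x / real (Suc n)))"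
    unfolding hardy_littlewood_Q_def
    by (rule suminf_split_initial_segment [OF summable_hardy_littlewood_Q])
  also have "(\<Sum>n<N - 1. 1 / real (Suc n) * sin (x / real (Suc n)))
      = (\<Sum>n=1..N - 1. 1 / real n * sin (x / real n))"
    by (rule sum.reindex_bij_witness [of _ "\<lambda>n. n - 1" Suc]) auto
  finally show ?thesis
    using assms by (simp add: summand_tower_1 del: summand_tower.simps One_nat_def)
qed

definition euler_maclaurin_term :: "nat \<Rightarrow> real \<Rightarrow> nat \<Rightarrow> real" where
  "euler_maclaurin_term N x m
    = bernoulli (2 * m) / fact (2 * m) * ((deriv ^^ (2 * m - 1)) G (real N / x) / x ^ (2 * m))"

lemma euler_maclaurin_term_eq_summand_tower:
  assumes "m > 0"
  shows "euler_maclaurin_term N x m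
    = bernoulli (2 * m) / fact (2 * m) * summand_tower x (2 * m) (real N)"
proof -
  obtain k where "2 * m = Suc k"
    using assms by (cases "2 * m") auto
  then show ?thesis
    by (simp add: euler_maclaurin_term_def)
qed

lemma bernoulli_operator_summand_tower:
  assumes "L > 0" "x \<noteq> 0"
  shows "bernoulli_operator (2 * L) (summand_tower x) (real N)
    = - Si (x / real N) - 1 / (2 * real N) * sin (x / real N)
      + (\<Sum>m=1..L. euler_maclaurin_term N x m)"
proof -
  have "bernoulli_operator (2 * L) (summand_tower x) (real N)
      = - Si (x / real N) - summand_tower x 1 (real N) / 2
        + (\<Sum>m=1..L. bernoulli (2 * m) * (summand_tower x (2 * m) (real N) / fact (2 * m)))"
    using sum_bernoulli_even [OF \<open>L > 0\<close>, of "\<lambda>k. summand_tower x k (real N) / fact k"]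
    by (simp add: bernoulli_operator_def)
  also have "(\<Sum>m=1..L. bernoulli (2 * m) * (summand_tower x (2 * m) (real N) / fact (2 * m)))
      = (\<Sum>m=1..L. euler_maclaurin_term N x m)"
    by (intro sum.cong refl) (simp add: euler_maclaurin_term_eq_summand_tower)
  finally show ?thesis
    by (simp only: summand_tower_1 [OF \<open>x \<noteq> 0\<close>]) simp
qed

lemma Q_error_plus_euler_maclaurin_terms:
  assumes "L > 0" "x \<noteq> 0" "N > 0"
  shows "Q_error N x + (\<Sum>m=1..L. euler_maclaurin_term N x m)
    = (\<Sum>n. summand_tower x 1 (real (n + N))) + bernoulli_operator (2 * L) (summand_tower x) (real N)"
  unfolding Q_error_def hardy_littlewood_Q_split [OF assms(2,3)]
    bernoulli_operator_summand_tower [OF assms(1,2)] by simp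

lemma abs_Q_error_plus_euler_maclaurin_terms_le:
  assumes "L > 0"
  obtains C where "\<And>N x. N > 0 \<Longrightarrow> real N \<le> x \<Longrightarrow>
    \<bar>Q_error N x + (\<Sum>m=1..L. euler_maclaurin_term N x m)\<bar> \<le> C * (x / (real N)\<^sup>2) ^ (2 * L)"
proof -
  have "2 * L > 0"
    using \<open>L > 0\<close> by simp
  then obtain C where decay: "\<And>a x t. 0 < a \<Longrightarrow> a \<le> x \<Longrightarrow> a \<le> t \<Longrightarrow>
      \<bar>summand_tower x (Suc (2 * L)) t\<bar> \<le> C * (x / a\<^sup>2) ^ (2 * L) * a / t\<^sup>2"
    using abs_summand_tower_le by blast
  define c where "c = (\<Sum>k\<le>2 * L. \<bar>bernoulli k\<bar> / fact k)"
  show thesis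
  proof (rule that)
    fix N :: nat and x :: real
    assume "N > 0" "real N \<le> x"
    then have "x > 0" by simp
    have "\<bar>Q_error N x + (\<Sum>m=1..L. euler_maclaurin_term N x m)\<bar>
        = \<bar>(\<Sum>n. summand_tower x 1 (real (n + N)))
            + bernoulli_operator (2 * L) (summand_tower x) (real N)\<bar>"
      using \<open>L > 0\<close> \<open>N > 0\<close> \<open>x > 0\<close> by (simp only: Q_error_plus_euler_maclaurin_terms less_imp_neq)
    also have "\<dots> \<le> c * (2 * (C * (x / (real N)\<^sup>2) ^ (2 * L) * real N) / real N)"
      unfolding c_def
    proof (rule euler_maclaurin_tail_quadratic_decay)
      show "summable (\<lambda>n. summand_tower x 1 (real (n + N)))"
        using \<open>x > 0\<close> by (intro summable_summand_tower_1) simp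
    qed (use \<open>L > 0\<close> \<open>N > 0\<close> \<open>x > 0\<close> \<open>real N \<le> x\<close> in
      \<open>simp_all add: has_real_derivative_summand_tower tendsto_summand_tower_at_top decay
        del: summand_tower.simps\<close>)
    finally show "\<bar>Q_error N x + (\<Sum>m=1..L. euler_maclaurin_term N x m)\<bar>
        \<le> 2 * c * C * (x / (real N)\<^sup>2) ^ (2 * L)"
      using \<open>N > 0\<close> by (simp add: mult_ac)
  qed
qed

lemma abs_euler_maclaurin_term_le:
  assumes "m > 0"
  obtains C where "\<And>N x. N > 0 \<Longrightarrow> real N \<le> x \<Longrightarrow>
    \<bar>euler_maclaurin_term N x m\<bar> \<le> C * ((x / (real N)\<^sup>2) ^ (2 * m) * (real N / x))"
proof -
  define k where "k = 2 * m - 1"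
  have k: "2 * m = Suc k" "k > 0"
    using \<open>m > 0\<close> by (auto simp: k_def)
  obtain C where bound: "\<And>a x t. 0 < a \<Longrightarrow> a \<le> x \<Longrightarrow> a \<le> t \<Longrightarrow>
      \<bar>summand_tower x (Suc k) t\<bar> \<le> C * (x / a\<^sup>2) ^ k * a / t\<^sup>2"
    using abs_summand_tower_le [OF \<open>k > 0\<close>] by blast
  define b where "b = \<bar>bernoulli (2 * m) / fact (2 * m)\<bar>"
  show thesis
  proof (rule that)
    fix N :: nat and x :: real
    assume "N > 0" "real N \<le> x"
    have "\<bar>euler_maclaurin_term N x m\<bar> = b * \<bar>summand_tower x (Suc k) (real N)\<bar>"
      unfolding euler_maclaurin_term_eq_summand_tower [OF \<open>m > 0\<close>] b_def k by (rule abs_mult)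
    also have "\<dots> \<le> b * (C * (x / (real N)\<^sup>2) ^ k * real N / (real N)\<^sup>2)"
      using \<open>N > 0\<close> \<open>real N \<le> x\<close> by (intro mult_left_mono bound) (auto simp: b_def)
    also have "\<dots> = b * C * ((x / (real N)\<^sup>2) ^ (2 * m) * (real N / x))"
      using \<open>N > 0\<close> \<open>real N \<le> x\<close> by (simp add: k power2_eq_square)
    finally show "\<bar>euler_maclaurin_term N x m\<bar>
        \<le> b * C * ((x / (real N)\<^sup>2) ^ (2 * m) * (real N / x))" .
  qed
qed

subsection \<open>The cutoff\<close>

lemma cutoff_le_powr: "real (cutoff \<epsilon> x) \<le> x powr (1 / 2 + \<epsilon>)"
  by (simp add: cutoff_def)

lemma powr_le_double_cutoff:
  assumes "x \<ge> 1" "\<epsilon> \<ge> - 1 / 2"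
  shows "x powr (1 / 2 + \<epsilon>) \<le> 2 * real (cutoff \<epsilon> x)"
proof -
  define y where "y = x powr (1 / 2 + \<epsilon>)"
  have "1 \<le> y"
    unfolding y_def using assms by (intro ge_one_powr_ge_zero) auto
  then have "1 \<le> \<lfloor>y\<rfloor>"
    by simp
  then have "y \<le> 2 * real_of_int \<lfloor>y\<rfloor>"
    by linarith
  with \<open>1 \<le> y\<close> show ?thesis
    by (simp add: cutoff_def y_def)
qed

lemma cutoff_pos:
  assumes "x \<ge> 1" "\<epsilon> \<ge> - 1 / 2"
  shows "cutoff \<epsilon> x > 0"
proof -
  have "0 < x powr (1 / 2 + \<epsilon>)"
    using assms by simp
  with powr_le_double_cutoff [OF assms] have "0 < real (cutoff \<epsilon> x)"
    by linarith
  then show ?thesis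
    by simp
qed

lemma cutoff_le_self:
  assumes "x \<ge> 1" "\<epsilon> \<le> 1 / 2"
  shows "real (cutoff \<epsilon> x) \<le> x"
proof -
  have "x powr (1 / 2 + \<epsilon>) \<le> x powr 1"
    using assms by (intro powr_mono) auto
  with cutoff_le_powr [of \<epsilon> x] assms show ?thesis
    by simp
qed

lemma bigo_cutoffI:
  fixes f g :: "nat \<Rightarrow> real \<Rightarrow> real"
  assumes "- 1 / 2 \<le> \<epsilon>" "\<epsilon> \<le> 1 / 2"
    and bound: "\<And>N x. N > 0 \<Longrightarrow> real N \<le> x \<Longrightarrow> \<bar>f N x\<bar> \<le> C * g N x"
    and nonneg: "\<And>N x. N > 0 \<Longrightarrow> real N \<le> x \<Longrightarrow> 0 \<le> g N x"
  shows "(\<lambda>x. f (cutoff \<epsilon> x) x) \<in> O[principal {1..}](\<lambda>x. g (cutoff \<epsilon> x) x)"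
proof (rule bigoI [of _ C], unfold eventually_principal, intro ballI)
  fix x :: real assume "x \<in> {1..}"
  then have "cutoff \<epsilon> x > 0" "real (cutoff \<epsilon> x) \<le> x"
    using assms(1,2) by (auto intro: cutoff_pos cutoff_le_self)
  then show "norm (f (cutoff \<epsilon> x) x) \<le> C * norm (g (cutoff \<epsilon> x) x)"
    using bound nonneg by simp
qed

lemma bigo_principal_powr_mono:
  assumes "a \<le> b"
  shows "(\<lambda>x::real. x powr a) \<in> O[principal {1..}](\<lambda>x. x powr b)"
  by (rule bigoI [of _ 1]) (use assms in \<open>auto simp: eventually_principal intro: powr_mono\<close>)

lemma cutoff_over_self_bigo:
  "(\<lambda>x. real (cutoff \<epsilon> x) / x) \<in> O[principal {1..}](\<lambda>x. x powr (\<epsilon> - 1 / 2))"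
proof (rule bigoI [of _ 1], unfold eventually_principal, intro ballI)
  fix x :: real assume "x \<in> {1..}"
  then have "real (cutoff \<epsilon> x) / x \<le> x powr (1 / 2 + \<epsilon>) / x powr 1"
    using cutoff_le_powr [of \<epsilon> x] by (simp add: divide_right_mono)
  also have "\<dots> = x powr (\<epsilon> - 1 / 2)"
    unfolding powr_diff [symmetric] by (simp add: algebra_simps)
  finally show "norm (real (cutoff \<epsilon> x) / x) \<le> 1 * norm (x powr (\<epsilon> - 1 / 2))"
    using \<open>x \<in> {1..}\<close> by simp
qed

lemma self_over_cutoff_square_bigo:
  assumes "\<epsilon> \<ge> - 1 / 2"
  shows "(\<lambda>x. x / (real (cutoff \<epsilon> x))\<^sup>2) \<in> O[principal {1..}](\<lambda>x. x powr (- 2 * \<epsilon>))"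
proof (rule bigoI [of _ 4], unfold eventually_principal, intro ballI)
  fix x :: real assume "x \<in> {1..}"
  then have "x \<ge> 1" by simp
  have "x / (real (cutoff \<epsilon> x))\<^sup>2 \<le> x / (x powr (1 / 2 + \<epsilon>) / 2)\<^sup>2"
    using powr_le_double_cutoff [OF \<open>x \<ge> 1\<close> assms] cutoff_pos [OF \<open>x \<ge> 1\<close> assms] \<open>x \<ge> 1\<close>
    by (intro divide_left_mono power_mono) auto
  also have "\<dots> = 4 * (x powr 1 / x powr ((1 / 2 + \<epsilon>) * 2))"
    using \<open>x \<ge> 1\<close> by (simp add: power_divide powr_power mult_ac)
  also have "x powr 1 / x powr ((1 / 2 + \<epsilon>) * 2) = x powr (- 2 * \<epsilon>)"
    unfolding powr_diff [symmetric] by (simp add: algebra_simps)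
  finally show "norm (x / (real (cutoff \<epsilon> x))\<^sup>2) \<le> 4 * norm (x powr (- 2 * \<epsilon>))"
    using \<open>x \<ge> 1\<close> by simp
qed

lemma self_over_cutoff_square_power_bigo:
  assumes "\<epsilon> \<ge> - 1 / 2"
  shows "(\<lambda>x. (x / (real (cutoff \<epsilon> x))\<^sup>2) ^ n) \<in> O[principal {1..}](\<lambda>x. x powr (- 2 * real n * \<epsilon>))"
proof -
  have "\<forall>\<^sub>F x in principal {1..}. (x powr (- 2 * \<epsilon>)) ^ n = x powr (- 2 * real n * \<epsilon>)"
    by (auto simp: eventually_principal powr_power mult_ac)
  from landau_o.big.cong [OF this]
    landau_o.big_power [OF self_over_cutoff_square_bigo [OF assms], of n]
  show ?thesis by simp
qed

lemma euler_maclaurin_term_cutoff_bigo: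
  assumes "0 < \<epsilon>" "\<epsilon> < 1 / 2" "m > 0"
  shows "(\<lambda>x. euler_maclaurin_term (cutoff \<epsilon> x) x m)
    \<in> O[principal {1..}](\<lambda>x. x powr (- 1 / 2 - (4 * real m - 1) * \<epsilon>))"
proof -
  obtain C where bound: "\<And>N x. N > 0 \<Longrightarrow> real N \<le> x \<Longrightarrow>
      \<bar>euler_maclaurin_term N x m\<bar> \<le> C * ((x / (real N)\<^sup>2) ^ (2 * m) * (real N / x))"
    using abs_euler_maclaurin_term_le [OF \<open>m > 0\<close>] by blast
  have "(\<lambda>x. euler_maclaurin_term (cutoff \<epsilon> x) x m) \<in>
      O[principal {1..}](\<lambda>x. (x / (real (cutoff \<epsilon> x))\<^sup>2) ^ (2 * m) * (real (cutoff \<epsilon> x) / x))"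
    using assms by (intro bigo_cutoffI [OF _ _ bound]) auto
  also have "(\<lambda>x. (x / (real (cutoff \<epsilon> x))\<^sup>2) ^ (2 * m) * (real (cutoff \<epsilon> x) / x))
      \<in> O[principal {1..}](\<lambda>x. x powr (- 2 * real (2 * m) * \<epsilon>) * x powr (\<epsilon> - 1 / 2))"
    using assms
    by (intro landau_o.big.mult self_over_cutoff_square_power_bigo cutoff_over_self_bigo) auto
  also have "(\<lambda>x. x powr (- 2 * real (2 * m) * \<epsilon>) * x powr (\<epsilon> - 1 / 2))
      = (\<lambda>x. x powr (- 1 / 2 - (4 * real m - 1) * \<epsilon>))"
    unfolding powr_add [symmetric] by (simp add: algebra_simps)
  finally show ?thesis .
qed

lemma Q_error_plus_euler_maclaurin_terms_cutoff_bigo: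
  assumes "0 < \<epsilon>" "\<epsilon> < 1 / 2" "L > 0"
  shows "(\<lambda>x. Q_error (cutoff \<epsilon> x) x + (\<Sum>m=1..L. euler_maclaurin_term (cutoff \<epsilon> x) x m))
    \<in> O[principal {1..}](\<lambda>x. x powr (- 4 * real L * \<epsilon>))"
proof -
  obtain C where bound: "\<And>N x. N > 0 \<Longrightarrow> real N \<le> x \<Longrightarrow>
      \<bar>Q_error N x + (\<Sum>m=1..L. euler_maclaurin_term N x m)\<bar> \<le> C * (x / (real N)\<^sup>2) ^ (2 * L)"
    using abs_Q_error_plus_euler_maclaurin_terms_le [OF \<open>L > 0\<close>] by blast
  have "(\<lambda>x. Q_error (cutoff \<epsilon> x) x + (\<Sum>m=1..L. euler_maclaurin_term (cutoff \<epsilon> x) x m))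
      \<in> O[principal {1..}](\<lambda>x. (x / (real (cutoff \<epsilon> x))\<^sup>2) ^ (2 * L))"
    using assms by (intro bigo_cutoffI [OF _ _ bound]) auto
  also have "(\<lambda>x. (x / (real (cutoff \<epsilon> x))\<^sup>2) ^ (2 * L))
      \<in> O[principal {1..}](\<lambda>x. x powr (- 2 * real (2 * L) * \<epsilon>))"
    using assms by (intro self_over_cutoff_square_power_bigo) auto
  finally show ?thesis
    by simp
qed

lemma Q_error_cutoff_expansion_bigo:
  assumes "0 < \<epsilon>" "\<epsilon> < 1 / 2"
  shows "(\<lambda>x. Q_error (cutoff \<epsilon> x) x + (\<Sum>m=1..M. euler_maclaurin_term (cutoff \<epsilon> x) x m))
    \<in> O[principal {1..}](\<lambda>x. x powr (- 1 / 2 - (4 * real M + 3) * \<epsilon>))"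
    (is "_ \<in> O[_](\<lambda>x. x powr ?e)")
proof -
  define E where "E x m = euler_maclaurin_term (cutoff \<epsilon> x) x m" for x m
  obtain L where "max (real M + 1) (- ?e / (4 * \<epsilon>)) \<le> real L"
    using real_arch_simple [of "max (real M + 1) (- ?e / (4 * \<epsilon>))"] ..
  then have "L > M" "- ?e / (4 * \<epsilon>) \<le> real L"
    by auto
  then have "- 4 * real L * \<epsilon> \<le> ?e"
    using \<open>0 < \<epsilon>\<close> by (simp add: field_simps)
  then have "(\<lambda>x. Q_error (cutoff \<epsilon> x) x + (\<Sum>m=1..L. E x m)) \<in> O[principal {1..}](\<lambda>x. x powr ?e)"
    unfolding E_def using assms \<open>L > M\<close>
    by (intro landau_o.big_trans [OF Q_error_plus_euler_maclaurin_terms_cutoff_bigo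
          bigo_principal_powr_mono]) auto
  moreover have "(\<lambda>x. \<Sum>m\<in>{M<..L}. E x m) \<in> O[principal {1..}](\<lambda>x. x powr ?e)"
  proof (rule big_sum_in_bigo)
    fix m assume "m \<in> {M<..L}"
    then have "real M + 1 \<le> real m" "m > 0"
      by auto
    then have "(4 * real M + 3) * \<epsilon> \<le> (4 * real m - 1) * \<epsilon>"
      using \<open>0 < \<epsilon>\<close> by (intro mult_right_mono) auto
    then show "(\<lambda>x. E x m) \<in> O[principal {1..}](\<lambda>x. x powr ?e)"
      unfolding E_def
      by (intro landau_o.big_trans [OF euler_maclaurin_term_cutoff_bigo [OF assms \<open>m > 0\<close>]
            bigo_principal_powr_mono]) simp
  qed
  ultimately have "(\<lambda>x. Q_error (cutoff \<epsilon> x) x + (\<Sum>m=1..L. E x m) - (\<Sum>m\<in>{M<..L}. E x m))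
      \<in> O[principal {1..}](\<lambda>x. x powr ?e)"
    by (rule sum_in_bigo)
  moreover have "(\<Sum>m=1..L. E x m) = (\<Sum>m=1..M. E x m) + (\<Sum>m\<in>{M<..L}. E x m)" for x
  proof -
    have "{1..L} = {1..M} \<union> {M<..L}"
      using \<open>L > M\<close> by auto
    then show ?thesis
      by (simp only:) (rule sum.union_disjoint, auto)
  qed
  ultimately show ?thesis
    by (simp add: E_def)
qed

theorem theorem1:
  fixes \<epsilon> :: real and M :: nat
  assumes "0 < \<epsilon>" and "\<epsilon> < 1 / 2"
  shows "\<exists>C>0. \<forall>x::real. x \<ge> 1 \<longrightarrow>
    (let N = cutoff \<epsilon> x in
      \<bar>Q_error N x -
        (- (\<Sum>m = 1..M. bernoulli (2 * m) / fact (2 * m)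
              * ((deriv ^^ (2 * m - 1)) G (real N / x) / x ^ (2 * m))))\<bar>
      \<le> C * x powr (- 1 / 2 - (4 * real M + 3) * \<epsilon>))"
proof -
  obtain C where "C > 0" and "\<forall>\<^sub>F x in principal {1..}.
      norm (Q_error (cutoff \<epsilon> x) x + (\<Sum>m=1..M. euler_maclaurin_term (cutoff \<epsilon> x) x m))
        \<le> C * norm (x powr (- 1 / 2 - (4 * real M + 3) * \<epsilon>))"
    using Q_error_cutoff_expansion_bigo [OF assms] by (rule landau_o.bigE)
  then have "\<forall>x\<ge>1. \<bar>Q_error (cutoff \<epsilon> x) x + (\<Sum>m=1..M. euler_maclaurin_term (cutoff \<epsilon> x) x m)\<bar>
      \<le> C * x powr (- 1 / 2 - (4 * real M + 3) * \<epsilon>)"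
    by (simp add: eventually_principal)
  with \<open>C > 0\<close> show ?thesis
    unfolding Let_def diff_minus_eq_add euler_maclaurin_term_def by blast
qed

end
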